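(* Let $0<p\le1$, $q>1$, $\beta>0$, and let $k\ge1$ be an integer. Let $z_0$ be the unique zero in $[0,+\infty)$ of $f_{p,q}(z)=z^q-\beta^pk^{-\frac{q-p}{q}}z^p-\beta^pk^{-\frac{q-p}{q}}-1$, and let $\Psi:=\beta^p(1+z_0^p)+k^{\frac{q-p}{q}}$. Define $$T_1:=3^{2-2p}k^{\frac{2}{\min\{q,2\}}-\frac{2-2p}{q}}\left(\beta(1+z_0)k^{-\frac1p}+k^{-\frac1q}\right)^{2p},\qquad T_2:=k^{\frac{2}{\min\{q,2\}}-\frac{2q+2-2p}{q}}\Psi^2,$$ $$\Delta_{\rm Zhu}:=\frac{1}{\sqrt{1+T_1}},\qquad\Delta_{\rm new}:=\frac{1}{\sqrt{1+T_2}}.$$ Then $T_1\ge T_2$, and consequently $\Delta_{\rm new}\ge\Delta_{\rm Zhu}$. Moreover, equality holds when $p=1$, while the inequality is strict for $0<p<1$.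
   Context: It is known that $f_{p,q}$ has exactly one zero in $[0,+\infty)$. The quantities $\Delta_{\rm Zhu}$ and $\Delta_{\rm new}$ are two upper bounds on the restricted isometry constant $\delta_{2k}$ used as sufficient conditions for stable recovery by $\ell_p^p/\ell_q^p$ minimization. *)

theory Defs
  imports Complex_Main
begin

definition f_pq :: "real \<Rightarrow> real \<Rightarrow> real \<Rightarrow> nat \<Rightarrow> real \<Rightarrow> real" where
  "f_pq p q \<beta> k z =
     z powr q - \<beta> powr p * real k powr (- ((q - p) / q)) * z powr p
       - \<beta> powr p * real k powr (- ((q - p) / q)) - 1"

text \<open>The definite description is meaningful because, for \<open>0 < p \<le> 1 < q\<close>, \<open>\<beta> > 0\<close>, \<open>k \<ge> 1\<close>,
  there is exactly one such zero. This fact is not assumed anywhere: statements about \<open>z0\<close>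
  have to establish it.\<close>

definition z0 :: "real \<Rightarrow> real \<Rightarrow> real \<Rightarrow> nat \<Rightarrow> real" where
  "z0 p q \<beta> k = (THE z. 0 \<le> z \<and> f_pq p q \<beta> k z = 0)"

definition Psi :: "real \<Rightarrow> real \<Rightarrow> real \<Rightarrow> nat \<Rightarrow> real" where
  "Psi p q \<beta> k = \<beta> powr p * (1 + z0 p q \<beta> k powr p) + real k powr ((q - p) / q)"

definition T1 :: "real \<Rightarrow> real \<Rightarrow> real \<Rightarrow> nat \<Rightarrow> real" where
  "T1 p q \<beta> k =
     3 powr (2 - 2 * p) * real k powr (2 / min q 2 - (2 - 2 * p) / q)
       * (\<beta> * (1 + z0 p q \<beta> k) * real k powr (- (1 / p)) + real k powr (- (1 / q))) powr (2 * p)"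

definition T2 :: "real \<Rightarrow> real \<Rightarrow> real \<Rightarrow> nat \<Rightarrow> real" where
  "T2 p q \<beta> k = real k powr (2 / min q 2 - (2 * q + 2 - 2 * p) / q) * (Psi p q \<beta> k)\<^sup>2"

definition Delta_Zhu :: "real \<Rightarrow> real \<Rightarrow> real \<Rightarrow> nat \<Rightarrow> real" where
  "Delta_Zhu p q \<beta> k = 1 / sqrt (1 + T1 p q \<beta> k)"

definition Delta_new :: "real \<Rightarrow> real \<Rightarrow> real \<Rightarrow> nat \<Rightarrow> real" where
  "Delta_new p q \<beta> k = 1 / sqrt (1 + T2 p q \<beta> k)"

end

theory Submission
  imports Defs
begin

text \<open>After the common power of \<open>k\<close> is extracted, \<open>T\<^sub>2 \<le> T\<^sub>1\<close> is the square of the power mean inequality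
  \<open>a\<^sup>p + b\<^sup>p + c\<^sup>p \<le> 3\<^sup>1\<^sup>-\<^sup>p (a + b + c)\<^sup>p\<close> for \<open>a = \<beta>\<close>, \<open>b = \<beta> z\<^sub>0\<close>, \<open>c = k\<^bsup>1/p - 1/q\<^esup>\<close>.
  It is strict for \<open>p < 1\<close> because the equation for \<open>z\<^sub>0\<close> forces \<open>z\<^sub>0\<^bsup>q\<^esup> > 1\<close>, so that \<open>a \<noteq> b\<close>.\<close>

text \<open>The value \<open>w\<close> on the tangent is the mean of \<open>t\<close> and 1 with
  weights \<open>p\<close> and \<open>1 - p\<close>. Adding \<open>ln x \<le> x - 1\<close> at
  \<open>t / w\<close> and \<open>1 / w\<close> with these weights gives
  \<open>p * ln t < ln w\<close>; the first bound is strict since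
  \<open>t \<noteq> w\<close>.\<close>

lemma powr_less_tangent_at_1:
  fixes p t :: real
  assumes "0 < p" "p < 1" "0 < t" "t \<noteq> 1"
  shows "t powr p < 1 + p * (t - 1)"
proof -
  define w where "w = 1 + p * (t - 1)"
  have w: "w > 0"
  proof -
    have "w = (1 - p) + p * t" by (simp add: w_def algebra_simps)
    with assms show ?thesis by (simp add: add_pos_pos)
  qed
  have "t \<noteq> w"
  proof
    assume "t = w"
    then have "(1 - p) * (t - 1) = 0" by (simp add: w_def algebra_simps)
    with assms show False by simp
  qed
  then have "ln (t / w) \<noteq> t / w - 1"
    using ln_eq_minus_one[of "t / w"] w assms by auto
  moreover have "ln (t / w) \<le> t / w - 1"
    using w assms by (intro ln_le_minus_one) simp
  ultimately have "p * ln (t / w) < p * (t / w - 1)"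
    using assms by simp
  moreover have "(1 - p) * ln (1 / w) \<le> (1 - p) * (1 / w - 1)"
    using w assms by (intro mult_left_mono ln_le_minus_one) simp_all
  moreover have "p * ln (t / w) + (1 - p) * ln (1 / w) = p * ln t - ln w"
    using w assms by (simp add: ln_div algebra_simps)
  \<comment> \<open>The upper bounds cancel because the weighted mean of \<open>t / w\<close> and
    \<open>1 / w\<close> is 1.\<close>
  moreover have "p * (t / w - 1) + (1 - p) * (1 / w - 1) = 0"
  proof -
    have "p * (t / w - 1) + (1 - p) * (1 / w - 1) = (1 + p * (t - 1)) / w - 1"
      using w by (simp add: field_simps)
    also have "\<dots> = 0" using w by (simp flip: w_def)
    finally show ?thesis .
  qed
  ultimately have "p * ln t < ln w" by linarith
  then have "exp (p * ln t) < exp (ln w)" by simp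
  with w assms show ?thesis by (simp add: powr_def flip: w_def)
qed

text \<open>Scaling by the mean \<open>m\<close> makes the three arguments average to 1, so the
  linear terms of their tangent bounds at 1 cancel and the bounds sum to 3.\<close>

lemma powr_mean_3_strict:
  fixes p a b c :: real
  assumes p: "0 < p" "p < 1" and pos: "0 < a" "0 < b" "0 < c" and "a \<noteq> b"
  shows "a powr p + b powr p + c powr p < 3 powr (1 - p) * (a + b + c) powr p"
proof -
  define m where "m = (a + b + c) / 3"
  have m: "m > 0" using pos by (simp add: m_def)
  have le: "(x / m) powr p \<le> 1 + p * (x / m - 1)" if "0 < x" for x
    using powr_less_tangent_at_1[of p "x / m"] that m p by (cases "x / m = 1") auto
  have less: "(x / m) powr p < 1 + p * (x / m - 1)" if "0 < x" "x \<noteq> m" for x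
    using powr_less_tangent_at_1[of p "x / m"] that m p by auto
  have "a + b + c = 3 * m" by (simp add: m_def)
  then have "a / m + b / m + c / m = 3" using m by (simp flip: add_divide_distrib)
  moreover have "(1 + p * (a / m - 1)) + (1 + p * (b / m - 1)) + (1 + p * (c / m - 1))
      = 3 + p * (a / m + b / m + c / m - 3)"
    by (simp add: algebra_simps)
  ultimately have eq:
    "(1 + p * (a / m - 1)) + (1 + p * (b / m - 1)) + (1 + p * (c / m - 1)) = 3" by simp
  have "(a / m) powr p + (b / m) powr p + (c / m) powr p < 3"
  \<comment> \<open>Since \<open>a \<noteq> b\<close>, at least one of them differs from
    \<open>m\<close>, and its tangent bound is strict.\<close>
  proof (cases "a = m")
    case True
    then have "b \<noteq> m" using \<open>a \<noteq> b\<close> by simp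
    then show ?thesis using le[of a] less[of b] le[of c] eq pos by linarith
  next
    case False
    then show ?thesis using less[of a] le[of b] le[of c] eq pos by linarith
  qed
  then have "(a powr p + b powr p + c powr p) / m powr p < 3"
    using pos m by (simp add: powr_divide add_divide_distrib)
  then have "a powr p + b powr p + c powr p < 3 * m powr p"
    using m by (simp add: divide_less_eq)
  also have "3 * m powr p = 3 powr (1 - p) * (a + b + c) powr p"
    using pos by (simp add: m_def powr_divide powr_diff)
  finally show ?thesis .
qed

text \<open>Existence comes from the intermediate value theorem. The function need not be monotone,
  but beyond any zero it stays positive, which excludes a second zero.\<close>

lemma powr_minus_powr_unique_zero:
  fixes p q \<alpha> :: real
  assumes p: "0 < p" and pq: "p < q" and \<alpha>: "0 < \<alpha>"
  shows "\<exists>!z. 0 \<le> z \<and> z powr q - \<alpha> * z powr p - \<alpha> - 1 = 0"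
proof -
  define g where "g z = z powr q - \<alpha> * z powr p - \<alpha> - 1" for z :: real
  have g: "g z = z powr p * (z powr (q - p) - \<alpha>) - (\<alpha> + 1)" for z
    by (simp add: g_def right_diff_distrib flip: powr_add)
  have g_less: "g x < g y" if x: "0 \<le> x" "g x = 0" and "x < y" for x y
  proof -
    \<comment> \<open>At a zero this product equals \<open>\<alpha> + 1\<close>. As
      \<open>powr\<close> is never negative, both factors are positive, and both increase to the
      right of \<open>x\<close>.\<close>
    have "x powr p * (x powr (q - p) - \<alpha>) > 0" using x \<alpha> g[of x] by linarith
    then have "x powr (q - p) - \<alpha> > 0" "x powr p > 0"
      by (auto simp: zero_less_mult_iff)
    moreover have "x powr p < y powr p" "x powr (q - p) < y powr (q - p)"
      using x \<open>x < y\<close> p pq by (auto intro: powr_less_mono2)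
    ultimately have
      "x powr p * (x powr (q - p) - \<alpha>) < y powr p * (y powr (q - p) - \<alpha>)"
      by (intro mult_strict_mono) auto
    then show ?thesis by (simp add: g)
  qed
  \<comment> \<open>Chosen so that \<open>M powr (q - p) - \<alpha> = \<alpha> + 1\<close>, which
    makes \<open>g M\<close> factor with a visible sign.\<close>
  define M where "M = (2 * \<alpha> + 1) powr (1 / (q - p))"
  have M: "1 \<le> M" using \<alpha> pq by (simp add: M_def ge_one_powr_ge_zero)
  have "M powr (q - p) = 2 * \<alpha> + 1" using \<alpha> pq by (simp add: M_def powr_powr)
  then have "g M = (M powr p - 1) * (\<alpha> + 1)" by (simp add: g algebra_simps)
  moreover have "1 \<le> M powr p" using M p by (simp add: ge_one_powr_ge_zero)
  ultimately have "0 \<le> g M" using \<alpha> by simp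
  moreover have "g 1 \<le> 0" using \<alpha> by (simp add: g_def)
  moreover have "continuous_on {1..M} g"
    unfolding g_def by (intro continuous_intros) auto
  ultimately obtain z where "1 \<le> z" "g z = 0"
    using IVT'[of g 1 0 M] M by auto
  then have "\<exists>!z. 0 \<le> z \<and> g z = 0"
    by (metis g_less less_irrefl linorder_neqE_linordered_idom order_trans zero_le_one)
  then show ?thesis by (simp add: g_def)
qed

lemma z0_gt_1:
  assumes "0 < p" "p < q" "0 < \<beta>" "1 \<le> k"
  shows "1 < z0 p q \<beta> k"
proof -
  define \<alpha> where "\<alpha> = \<beta> powr p * real k powr (- ((q - p) / q))"
  have \<alpha>: "0 < \<alpha>" using assms by (simp add: \<alpha>_def)
  have f: "f_pq p q \<beta> k z = z powr q - \<alpha> * z powr p - \<alpha> - 1" for z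
    by (simp add: f_pq_def \<alpha>_def)
  \<comment> \<open>Unique existence is what turns the definite description \<open>z0\<close> into
    an actual zero.\<close>
  have "\<exists>!z. 0 \<le> z \<and> f_pq p q \<beta> k z = 0"
    unfolding f using assms \<alpha> by (intro powr_minus_powr_unique_zero)
  then have z: "0 \<le> z0 p q \<beta> k" "f_pq p q \<beta> k (z0 p q \<beta> k) = 0"
    unfolding z0_def by (metis (mono_tags, lifting) theI')+
  have "0 \<le> \<alpha> * z0 p q \<beta> k powr p" using \<alpha> by simp
  then have "1 < z0 p q \<beta> k powr q" using z \<alpha> unfolding f by linarith
  then show ?thesis
    using z assms powr_le1[of q "z0 p q \<beta> k"] by linarith
qed

text \<open>Taking \<open>k powr (- (1 / p))\<close> out of the bracket and raising it to the power
  \<open>2 * p\<close> yields \<open>k powr (- 2)\<close>, exactly the gap between the exponents of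
  \<open>k\<close> in \<open>T1\<close> and \<open>T2\<close>.\<close>

lemma T1_eq:
  assumes "0 < p" "0 < q" "0 < \<beta>" "1 \<le> k" "0 \<le> z0 p q \<beta> k"
  shows "T1 p q \<beta> k = real k powr (2 / min q 2 - (2 * q + 2 - 2 * p) / q) *
    (3 powr (1 - p) * (\<beta> + \<beta> * z0 p q \<beta> k + real k powr (1 / p - 1 / q)) powr p)\<^sup>2"
proof -
  define z where "z = z0 p q \<beta> k"
  define s where "s = \<beta> + \<beta> * z + real k powr (1 / p - 1 / q)"
  have k: "0 < real k" and s: "0 \<le> s"
    using assms by (auto simp: s_def z_def)
  have "\<beta> * (1 + z) * real k powr (- (1 / p)) + real k powr (- (1 / q))
      = real k powr (- (1 / p)) * s"
    using k by (simp add: s_def algebra_simps flip: powr_add)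
  moreover have "(real k powr (- (1 / p)) * s) powr (2 * p) = real k powr (- 2) * (s powr p)\<^sup>2"
    using k s assms by (simp add: powr_mult powr_powr power2_eq_square flip: powr_add)
  moreover have "3 powr (2 - 2 * p) = (3 powr (1 - p) :: real)\<^sup>2"
    by (simp add: power2_eq_square flip: powr_add)
  moreover have "real k powr (2 / min q 2 - (2 * q + 2 - 2 * p) / q)
      = real k powr (2 / min q 2 - (2 - 2 * p) / q) * real k powr (- 2)"
  proof -
    have "2 / min q 2 - (2 * q + 2 - 2 * p) / q = (2 / min q 2 - (2 - 2 * p) / q) + (- 2)"
      using assms by (simp add: field_simps)
    then show ?thesis by (simp only: powr_add)
  qed
  ultimately show ?thesis
    unfolding T1_def z_def[symmetric] s_def[symmetric] by (simp only: power_mult_distrib mult_ac)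
qed

theorem proposition5p6:
  fixes p q \<beta> :: real and k :: nat
  assumes "0 < p" and "p \<le> 1" and "1 < q" and "0 < \<beta>" and "1 \<le> k"
  shows "T1 p q \<beta> k \<ge> T2 p q \<beta> k
       \<and> Delta_new p q \<beta> k \<ge> Delta_Zhu p q \<beta> k
       \<and> (p = 1 \<longrightarrow> T1 p q \<beta> k = T2 p q \<beta> k \<and> Delta_new p q \<beta> k = Delta_Zhu p q \<beta> k)
       \<and> (p < 1 \<longrightarrow> T1 p q \<beta> k > T2 p q \<beta> k \<and> Delta_new p q \<beta> k > Delta_Zhu p q \<beta> k)"
proof -
  define z where "z = z0 p q \<beta> k"
  define c where "c = real k powr (1 / p - 1 / q)"
  define K where "K = real k powr (2 / min q 2 - (2 * q + 2 - 2 * p) / q)"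
  define S where "S = 3 powr (1 - p) * (\<beta> + \<beta> * z + c) powr p"
  have z: "1 < z" using z0_gt_1[of p q \<beta> k] assms by (simp add: z_def)
  have K: "0 < K" and c: "0 < c" using assms by (auto simp: K_def c_def)
  have T1: "T1 p q \<beta> k = K * S\<^sup>2"
    using T1_eq[of p q \<beta> k] assms z by (simp add: K_def S_def z_def c_def)
  \<comment> \<open>This exhibits the last summand of \<open>Psi\<close> as \<open>c powr p\<close>,
    so that \<open>Psi\<close> is a sum of three \<open>p\<close>-th powers.\<close>
  have "(1 / p - 1 / q) * p = (q - p) / q" using assms by (simp add: field_simps)
  then have "c powr p = real k powr ((q - p) / q)" by (simp add: c_def powr_powr)
  then have Psi: "Psi p q \<beta> k = \<beta> powr p + (\<beta> * z) powr p + c powr p"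
    using assms z by (simp add: Psi_def powr_mult algebra_simps flip: z_def)
  have T2: "T2 p q \<beta> k = K * (Psi p q \<beta> k)\<^sup>2" by (simp add: T2_def K_def)
  have T2_nonneg: "0 \<le> T2 p q \<beta> k" using K by (simp add: T2)
  have eq: "T1 p q \<beta> k = T2 p q \<beta> k" if "p = 1"
  proof -
    have "S = Psi p q \<beta> k" unfolding Psi using that assms z c by (simp add: S_def)
    then show ?thesis by (simp add: T1 T2)
  qed
  have less: "T2 p q \<beta> k < T1 p q \<beta> k" if "p < 1"
  proof -
    \<comment> \<open>The required \<open>\<beta> \<noteq> \<beta> * z\<close> follows from
      \<open>1 < z\<close>.\<close>
    have "Psi p q \<beta> k < S"
      unfolding Psi S_def using that assms z c by (intro powr_mean_3_strict) auto
    moreover have "0 \<le> Psi p q \<beta> k" by (simp add: Psi)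
    ultimately show ?thesis using K by (simp add: T1 T2 power_strict_mono)
  qed
  \<comment> \<open>The map from \<open>T\<close> to \<open>1 / sqrt (1 + T)\<close> is strictly
    decreasing for \<open>T \<ge> 0\<close>.\<close>
  have "Delta_Zhu p q \<beta> k < Delta_new p q \<beta> k" if "T2 p q \<beta> k < T1 p q \<beta> k"
    unfolding Delta_Zhu_def Delta_new_def using that T2_nonneg by (simp add: frac_less2)
  moreover have "Delta_Zhu p q \<beta> k = Delta_new p q \<beta> k" if "T1 p q \<beta> k = T2 p q \<beta> k"
    using that by (simp add: Delta_Zhu_def Delta_new_def)
  ultimately show ?thesis using eq less \<open>p \<le> 1\<close> by (cases "p = 1") auto
qed

end
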